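(* Let $G$ be any simple finite graph with vertex set $\{v_1,\dots,v_n\}$ having an edge between vertices $v_i$ and $v_j$ ($i\neq j$). If a symmetric subgraph $J$ of $K_{n,n}$ contains the edges $(i,i')$, $(i,j')$ and $(j,i')$, then $\chi_\infty(G,J)=\infty$.
   Context: Let $K_{n,n}$ be the complete bipartite graph with parts $I_n=\{1,\dots,n\}$ and $I_n'=\{1',\dots,n'\}$; a subgraph $J$ of $K_{n,n}$ with vertex set $I_n\cup I_n'$ is symmetric if $i\sim j'$ iff $j\sim i'$. The self-similar graphs based on $(G,J)$: $G^1=G$; for $k\ge2$, $V(G^k)=V(G)^k$, and $(v_{i_1},\dots,v_{i_k})\sim(v_{j_1},\dots,v_{j_k})$ in $G^k$ iff either (1) $(v_{i_1},\dots,v_{i_{k-1}})=(v_{j_1},\dots,v_{j_{k-1}})$ and $v_{i_k}\sim v_{j_k}$ in $G$, or (2) $(v_{i_1},\dots,v_{i_{k-1}})\sim(v_{j_1},\dots,v_{j_{k-1}})$ in $G^{k-1}$ and $i_k\sim j_k'$ in $J$. The sequence $\chi(G^k)$ is non-decreasing; $\chi_\infty(G,J)$ denotes its limit, with $\chi_\infty(G,J)=\infty$ if it is unbounded. *)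

theory Defs
  imports "Graph_Theory.Graph_Theory"
begin

text \<open>
  Finite simple graphs are modelled by the locale \<^locale>\<open>pair_graph\<close>: an undirected edge
  is a pair of opposite arcs.
\<close>

definition proper_colouring :: "'a pair_pre_digraph \<Rightarrow> nat \<Rightarrow> ('a \<Rightarrow> nat) \<Rightarrow> bool" where
  "proper_colouring G m c \<longleftrightarrow>
     (\<forall>u \<in> pverts G. c u < m) \<and> (\<forall>(u, w) \<in> parcs G. c u \<noteq> c w)"

definition chromatic_number :: "'a pair_pre_digraph \<Rightarrow> nat" where
  "chromatic_number G = (LEAST m. \<exists>c. proper_colouring G m c)"

text \<open>
  The graph $K_{n,n}$; the vertex $i$ of the first part is encoded as \<^term>\<open>Inl i\<close> and the
  vertex $i'$ of the second part as \<^term>\<open>Inr i\<close>.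
\<close>

definition complete_bipartite :: "nat \<Rightarrow> (nat + nat) pair_pre_digraph" where
  "complete_bipartite n =
     \<lparr> pverts = Inl ` {1..n} \<union> Inr ` {1..n},
       parcs = Inl ` {1..n} \<times> Inr ` {1..n} \<union> Inr ` {1..n} \<times> Inl ` {1..n} \<rparr>"

text \<open>
  The constant \<^const>\<open>spanning\<close> speaks about digraphs, so that \<^term>\<open>J\<close> is undirected has to
  be required separately. This is not to be confused with the last conjunct, which is invariance
  under exchanging the two parts.
\<close>

definition symmetric_subgraph :: "nat \<Rightarrow> (nat + nat) pair_pre_digraph \<Rightarrow> bool" where
  "symmetric_subgraph n J \<longleftrightarrow>
     pair_graph J \<and> spanning (with_proj J) (with_proj (complete_bipartite n)) \<and>
     (\<forall>i \<in> {1..n}. \<forall>j \<in> {1..n}. (Inl i, Inr j) \<in> parcs J \<longleftrightarrow> (Inl j, Inr i) \<in> parcs J)"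

text \<open>
  The graph $G^k$ for a graph \<^term>\<open>G\<close> whose vertices are enumerated as
  \<^term>\<open>v 1\<close>, ..., \<^term>\<open>v n\<close>. A \<^term>\<open>k\<close>-tuple of vertices is a list of length \<^term>\<open>k\<close>;
  hence $G^1$ is \<^term>\<open>G\<close> with each vertex \<^term>\<open>u\<close> written as \<^term>\<open>[u]\<close>.
  The construction starts at exponent 1; the value at 0 is a dummy.
\<close>

fun self_similar_graph ::
  "nat \<Rightarrow> (nat \<Rightarrow> 'a) \<Rightarrow> 'a pair_pre_digraph \<Rightarrow> (nat + nat) pair_pre_digraph \<Rightarrow> nat
    \<Rightarrow> 'a list pair_pre_digraph" where
  "self_similar_graph n v G J 0 = \<lparr> pverts = {[]}, parcs = {} \<rparr>"
| "self_similar_graph n v G J (Suc 0) =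
     \<lparr> pverts = {[u] | u. u \<in> pverts G},
       parcs = {([u], [w]) | u w. (u, w) \<in> parcs G} \<rparr>"
| "self_similar_graph n v G J (Suc (Suc k)) =
     \<lparr> pverts = {xs \<in> lists (pverts G). length xs = Suc (Suc k)},
       parcs = {(xs @ [v i], ys @ [v j]) | xs ys i j.
         i \<in> {1..n} \<and> j \<in> {1..n} \<and>
         xs \<in> lists (pverts G) \<and> length xs = Suc k \<and>
         ys \<in> lists (pverts G) \<and> length ys = Suc k \<and>
         (xs = ys \<and> (v i, v j) \<in> parcs G \<or>
          (xs, ys) \<in> parcs (self_similar_graph n v G J (Suc k)) \<and> (Inl i, Inr j) \<in> parcs J)} \<rparr>"

text \<open>
  The limit is taken in \<^typ>\<open>enat\<close>, so a non-decreasing unbounded sequence has limit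
  \<^term>\<open>\<infinity> :: enat\<close>. The sequence is indexed from 0, so its term at \<^term>\<open>k\<close> belongs to $G^{k+1}$.
\<close>

definition chromatic_limit ::
  "nat \<Rightarrow> (nat \<Rightarrow> 'a) \<Rightarrow> 'a pair_pre_digraph \<Rightarrow> (nat + nat) pair_pre_digraph \<Rightarrow> enat" where
  "chromatic_limit n v G J =
     lim (\<lambda>k. enat (chromatic_number (self_similar_graph n v G J (Suc k))))"

end

theory Submission
  imports Defs
begin

text \<open>
  The graphs contain arbitrarily large cliques: if \<^term>\<open>C\<close> is a clique of $G^k$ and
  \<^term>\<open>z \<in> C\<close>, then the words \<^term>\<open>x @ [v i]\<close> with \<^term>\<open>x \<in> C\<close> together with
  \<^term>\<open>z @ [v j]\<close> form a clique of $G^{k+1}$ with one more vertex, since \<^term>\<open>z @ [v j]\<close> is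
  joined to \<^term>\<open>z @ [v i]\<close> through \<^term>\<open>G\<close> and to the others through \<^term>\<open>J\<close>.
\<close>

text \<open>Guarantees that the \<open>LEAST\<close> in \<open>chromatic_number\<close> is attained:
  an injective numbering of the finitely many vertices is proper because there are no loops.\<close>

lemma (in pair_digraph) ex_proper_colouring:
  "\<exists>m c. proper_colouring G m c"
proof -
  obtain c :: "'a \<Rightarrow> nat" and m where c: "inj_on c (pverts G)" "c ` pverts G = {i. i < m}"
    using finite_imp_inj_to_nat_seg[OF pair_finite_verts] by metis
  have "c u \<noteq> c w" if "(u, w) \<in> parcs G" for u w
    using that c(1) in_arcsD1 in_arcsD2 pair_no_loops by (metis inj_onD fst_conv snd_conv)
  then show ?thesis
    using c(2) unfolding proper_colouring_def by blast
qed

lemma card_clique_le_colours: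
  assumes "proper_colouring G m c"
    and "C \<subseteq> pverts G"
    and "pairwise (\<lambda>x y. (x, y) \<in> parcs G) C"
  shows "card C \<le> m"
proof -
  have "inj_on c C"
    using assms unfolding inj_on_def pairwise_def proper_colouring_def by blast
  moreover have "c ` C \<subseteq> {..<m}"
    using assms unfolding proper_colouring_def by auto
  ultimately show ?thesis
    by (metis card_inj_on_le card_lessThan finite_lessThan)
qed

lemma (in pair_digraph) card_clique_le_chromatic_number:
  assumes "C \<subseteq> pverts G"
    and "pairwise (\<lambda>x y. (x, y) \<in> parcs G) C"
  shows "card C \<le> chromatic_number G"
proof -
  have "\<exists>c. proper_colouring G (chromatic_number G) c"
    unfolding chromatic_number_def using ex_proper_colouring by (rule LeastI_ex)
  then show ?thesis
    using assms card_clique_le_colours by blast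
qed

lemma pverts_self_similar_graph:
  "pverts (self_similar_graph n v G J (Suc k)) = {xs. set xs \<subseteq> pverts G \<and> length xs = Suc k}"
proof (cases k)
  case 0
  then show ?thesis
    by (auto simp: length_Suc_conv)
next
  case (Suc l)
  then show ?thesis
    by auto
qed

lemma pair_digraphI:
  assumes "finite (pverts G)"
    and "parcs G \<subseteq> pverts G \<times> pverts G"
    and "\<And>u. (u, u) \<notin> parcs G"
  shows "pair_digraph G"
proof -
  have "finite (parcs G)"
    using assms(1,2) by (meson finite_SigmaI finite_subset)
  then show ?thesis
    using assms by unfold_locales auto
qed

text \<open>Supplies the finiteness and loop-freeness on which the clique bound rests; the range
  condition on \<open>v\<close> keeps the appended letters among the vertices.\<close>

lemma pair_digraph_self_similar_graph:
  assumes "pair_digraph G" and "v ` {1..n} \<subseteq> pverts G"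
  shows "pair_digraph (self_similar_graph n v G J (Suc k))"
proof (rule pair_digraphI)
  interpret pair_digraph G by fact
  let ?H = "self_similar_graph n v G J"
  have loopfree: "(u, u) \<notin> parcs G" for u
    using pair_no_loops by fastforce
  show "finite (pverts (?H (Suc k)))"
    unfolding pverts_self_similar_graph using pair_finite_verts by (rule finite_lists_length_eq)
  show "parcs (?H (Suc k)) \<subseteq> pverts (?H (Suc k)) \<times> pverts (?H (Suc k))"
  proof (cases k)
    case 0
    then show ?thesis
      using in_arcsD1 in_arcsD2 by auto
  next
    case (Suc l)
    have "v p \<in> pverts G" if "p \<in> {1..n}" for p
      using assms(2) that by blast
    with Suc show ?thesis
      by auto
  qed
  \<comment> \<open>Even if \<open>J\<close> joins i to i', no loop arises: equal words have equal
    prefixes, so a loop would come from a loop of \<open>G\<close> at the last letter or from a loop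
    one exponent lower.\<close>
  show "(x, x) \<notin> parcs (?H (Suc k))" for x
  proof (induction k arbitrary: x)
    case 0
    then show ?case
      using loopfree by auto
  next
    case (Suc k)
    then show ?case
      using loopfree by (auto simp del: self_similar_graph.simps(2))
  qed
qed

lemma ex_clique_self_similar_graph:
  assumes ij: "i \<in> {1..n}" "j \<in> {1..n}"
    and v: "v i \<in> pverts G" "v j \<in> pverts G" "v i \<noteq> v j"
    and G: "(v i, v j) \<in> parcs G" "(v j, v i) \<in> parcs G"
    and J: "(Inl i, Inr i) \<in> parcs J" "(Inl i, Inr j) \<in> parcs J" "(Inl j, Inr i) \<in> parcs J"
  shows "\<exists>C \<subseteq> pverts (self_similar_graph n v G J (Suc k)). card C = k + 2 \<and>
    pairwise (\<lambda>x y. (x, y) \<in> parcs (self_similar_graph n v G J (Suc k))) C"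
proof (induction k)
  case 0
  \<comment> \<open>At exponent 1 the clique is the given edge; hence the size k + 2 at exponent k +
    1.\<close>
  show ?case
    by (rule exI[of _ "{[v i], [v j]}"]) (use v G in \<open>auto simp: pairwise_insert\<close>)
next
  case (Suc k)
  let ?H = "self_similar_graph n v G J"
  obtain C where C: "C \<subseteq> pverts (?H (Suc k))" "card C = k + 2"
    "pairwise (\<lambda>x y. (x, y) \<in> parcs (?H (Suc k))) C"
    using Suc.IH by blast
  then obtain z where z: "z \<in> C"
    by fastforce
  define D where "D = insert (z @ [v j]) ((\<lambda>x. x @ [v i]) ` C)"
  have verts: "set x \<subseteq> pverts G \<and> length x = Suc k" if "x \<in> C" for x
    using C(1) that by (auto simp: pverts_self_similar_graph simp del: self_similar_graph.simps)
  \<comment> \<open>Treats all adjacencies in \<open>D\<close> at once: words with the same prefix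
    are joined through \<open>G\<close>, the others through \<open>J\<close>. The pair (j, j) is
    excluded since no edge (j, j') of \<open>J\<close> is given; it never arises from distinct
    members of \<open>D\<close>, as only one of them ends in \<open>v j\<close>.\<close>
  have step: "(x @ [v p], y @ [v q]) \<in> parcs (?H (Suc (Suc k)))"
    if "x \<in> C" "y \<in> C" "p \<in> {i, j}" "q \<in> {i, j}" "(p, q) \<noteq> (j, j)" "x = y \<longrightarrow> p \<noteq> q"
    for x y p q
  proof -
    have "x = y \<and> (v p, v q) \<in> parcs G \<or>
        (x, y) \<in> parcs (?H (Suc k)) \<and> (Inl p, Inr q) \<in> parcs J"
      using that G J C(3) by (auto dest: pairwiseD)
    moreover have "p \<in> {1..n}" "q \<in> {1..n}"
      using that ij by auto
    ultimately show ?thesis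
      using verts[OF that(1)] verts[OF that(2)]
      by (simp only: self_similar_graph.simps pair_pre_digraph.simps in_lists_conv_set) blast
  qed
  have ne: "i \<noteq> j"
    using v by auto
  \<comment> \<open>An infinite set has \<open>card\<close> 0, which is not k + 2.\<close>
  have "finite C"
    using C(2) card.infinite by fastforce
  \<comment> \<open>\<open>z @ [v j]\<close> is new, as all other words of \<open>D\<close> end in
    \<open>v i\<close>.\<close>
  then have "card D = Suc k + 2"
    using C(2) v(3) unfolding D_def by (subst card_insert_disjoint) (auto simp: card_image inj_on_def)
  moreover have "D \<subseteq> pverts (?H (Suc (Suc k)))"
    using verts z v unfolding D_def pverts_self_similar_graph by force
  moreover have "pairwise (\<lambda>x y. (x, y) \<in> parcs (?H (Suc (Suc k)))) D"
    unfolding D_def pairwise_insert pairwise_image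
    using ne by (auto simp: pairwise_def simp del: self_similar_graph.simps intro!: step z)
  ultimately show ?case
    by blast
qed

theorem theorem3p4:
  fixes G :: "'a pair_pre_digraph"
    and J :: "(nat + nat) pair_pre_digraph"
    and v :: "nat \<Rightarrow> 'a"
    and n i j :: nat
  assumes "pair_graph G"
    and "bij_betw v {1..n} (pverts G)"
    and "i \<in> {1..n}" and "j \<in> {1..n}" and "i \<noteq> j"
    and "(v i, v j) \<in> parcs G"
    and "symmetric_subgraph n J"
    and "(Inl i, Inr i) \<in> parcs J"
    and "(Inl i, Inr j) \<in> parcs J"
    and "(Inl j, Inr i) \<in> parcs J"
  shows "chromatic_limit n v G J = \<infinity>"
proof -
  interpret pair_graph G by fact
  let ?\<chi> = "\<lambda>k. chromatic_number (self_similar_graph n v G J (Suc k))"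
  have image: "v ` {1..n} = pverts G"
    using assms(2) by (simp add: bij_betw_def)
  have v: "v i \<in> pverts G" "v j \<in> pverts G" "v i \<noteq> v j"
    using assms(3-5) image bij_betw_imp_inj_on[OF assms(2)] by (blast dest: inj_onD)+
  have vji: "(v j, v i) \<in> parcs G"
    using assms(6) arcs_symmetric by blast
  \<comment> \<open>Index k stands for exponent k + 1, whose clique has k + 2 vertices.\<close>
  have lower: "k < ?\<chi> k" for k
  proof -
    interpret H: pair_digraph "self_similar_graph n v G J (Suc k)"
      by (rule pair_digraph_self_similar_graph) (use pair_digraph_axioms image in auto)
    obtain C where C: "C \<subseteq> pverts (self_similar_graph n v G J (Suc k))" "card C = k + 2"
      "pairwise (\<lambda>x y. (x, y) \<in> parcs (self_similar_graph n v G J (Suc k))) C"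
      using ex_clique_self_similar_graph[OF assms(3,4) v assms(6) vji assms(8-10)] by blast
    then show ?thesis
      using H.card_clique_le_chromatic_number[OF C(1,3)] by linarith
  qed
  \<comment> \<open>\<open>lim\<close> is a definite description, so convergence is shown first.
    Only lower bounds matter: nothing lies above \<infinity>, and the closing \<open>simp\<close>
    settles that half.\<close>
  have "(\<lambda>k. enat (?\<chi> k)) \<longlonglongrightarrow> \<infinity>"
  proof (rule order_tendstoI)
    fix y :: enat
    assume "y < \<infinity>"
    then obtain m where "y = enat m"
      by (rule less_infinityE)
    then have "y < enat (?\<chi> k)" if "m \<le> k" for k
      using lower[of k] that by simp
    then show "\<forall>\<^sub>F k in sequentially. y < enat (?\<chi> k)"
      by (rule eventually_sequentiallyI)
  qed simp
  then show ?thesis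
    unfolding chromatic_limit_def by (rule limI)
qed

end
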